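(* Let $f:\mathbb{R}^n\to\mathbb{R}$ be $L$-smooth and $\alpha$-strongly convex ($L,\alpha>0$), let $\Psi:\mathbb{R}^n\to\mathbb{R}\cup\{+\infty\}$ be closed, proper and convex, let $F=f+\Psi$, let $\mathbf{x}^*$ be the minimizer of $F$, and let $\kappa=L/\alpha$. Fix $\mathbf{x}_0\in\mathbb{R}^n$, let $\{\mathbf{x}_k,\mathbf{w}_k\}_{k\ge0}$ be generated by the accelerated gradient algorithm described in the context, and let $\mathbf{y}_k$ and $\tilde\sigma_k^2$ be the auxiliary quantities defined in the context. Then for each $k=0,1,\ldots$, $$\|\mathbf{y}_k-\mathbf{x}^*\|^2+\frac{2(F(\mathbf{x}_k)-F(\mathbf{x}^* ))}{\alpha}\le\tilde\sigma_k^2 .$$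
   Context: $f$ is $L$-smooth if it is differentiable and $|f(\mathbf{x})-f(\mathbf{y})-\nabla f(\mathbf{y})^T(\mathbf{x}-\mathbf{y})|\le (L/2)\|\mathbf{x}-\mathbf{y}\|^2$ for all $\mathbf{x},\mathbf{y}$; $f$ is $\alpha$-strongly convex if $f(\mathbf{y})\ge f(\mathbf{x})+\nabla f(\mathbf{x})^T(\mathbf{y}-\mathbf{x})+(\alpha/2)\|\mathbf{x}-\mathbf{y}\|^2$ for all $\mathbf{x},\mathbf{y}$. $\mathrm{prox}_{t\Psi}(\mathbf{x})=\operatorname{argmin}_{\mathbf{z}}\{\Psi(\mathbf{z})+\|\mathbf{x}-\mathbf{z}\|^2/(2t)\}$ for $t>0$. Accelerated gradient: set $\mathbf{w}_0=\mathbf{x}_0$; for $k=1,2,\ldots$ let $\mathbf{x}_k=\mathrm{prox}_{\Psi/L}\left(\mathbf{w}_{k-1}-\frac1L\nabla f(\mathbf{w}_{k-1})\right)$ and $\mathbf{w}_k=\mathbf{x}_k+\theta(\mathbf{x}_k-\mathbf{x}_{k-1})$, where $\theta=\frac{\sqrt\kappa-1}{\sqrt\kappa+1}$. Auxiliary quantities: $\tau=\sqrt\kappa-1$; $\mathbf{y}_0=\mathbf{x}_0$ and $\mathbf{y}_k=\mathbf{x}_k+\tau(\mathbf{x}_k-\mathbf{x}_{k-1})$ for $k\ge1$; $\tilde\sigma_0^2=\|\mathbf{y}_0-\mathbf{x}^*\|^2+\frac{2(F(\mathbf{x}_0)-F(\mathbf{x}^* ))}{\alpha}$ and, for $k\ge0$,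 $\tilde\sigma_{k+1}^2=(1-\kappa^{-1/2})\tilde\sigma_k^2-(\kappa^{1/2}-\kappa^{-1/2})\|\mathbf{w}_k-\mathbf{x}_k\|^2$. (The symbols $\tilde\sigma_k^2$ are names of numbers; the content is for $F(\mathbf{x}_0)<\infty$.) *)

theory Defs
  imports "HOL-Analysis.Analysis"
begin

(* Meaningful at points of differentiability, where the gradient exists and is unique
   (see GDERIV_grad). *)
definition grad :: "('a::euclidean_space \<Rightarrow> real) \<Rightarrow> 'a \<Rightarrow> 'a" where
  "grad f x = (THE D. GDERIV f x :> D)"

lemma GDERIV_grad:
  fixes f :: "'a::euclidean_space \<Rightarrow> real"
  assumes "f differentiable (at x)"
  shows "GDERIV f x :> grad f x"
proof -
  obtain f' where f': "(f has_derivative f') (at x)"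
    using assms by (auto simp: differentiable_def)
  then have "linear f'"
    by (rule has_derivative_linear)
  then have "f' = (\<lambda>h. h \<bullet> adjoint f' 1)"
    by (simp add: adjoint_works fun_eq_iff)
  with f' obtain D where "GDERIV f x :> D"
    unfolding gderiv_def by metis
  moreover have "D = E" if "GDERIV f x :> D" "GDERIV f x :> E" for D E
  proof -
    have "(\<lambda>h. h \<bullet> D) = (\<lambda>h. h \<bullet> E)"
      using that unfolding gderiv_def by (rule has_derivative_unique)
    then show ?thesis
      by (simp add: fun_eq_iff vector_eq_ldot)
  qed
  ultimately show ?thesis
    unfolding grad_def by (metis theI)
qed

definition L_smooth :: "real \<Rightarrow> ('a::euclidean_space \<Rightarrow> real) \<Rightarrow> bool" where
  "L_smooth L f \<longleftrightarrow>
     (\<forall>x. f differentiable (at x)) \<and>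
     (\<forall>x y. \<bar>f x - f y - grad f y \<bullet> (x - y)\<bar> \<le> (L / 2) * (norm (x - y))\<^sup>2)"

(* Only to be used for differentiable f. *)
definition strongly_convex :: "real \<Rightarrow> ('a::euclidean_space \<Rightarrow> real) \<Rightarrow> bool" where
  "strongly_convex \<alpha> f \<longleftrightarrow>
     (\<forall>x y. f y \<ge> f x + grad f x \<bullet> (y - x) + (\<alpha> / 2) * (norm (x - y))\<^sup>2)"

definition ext_epigraph :: "('a \<Rightarrow> ereal) \<Rightarrow> ('a \<times> real) set" where
  "ext_epigraph \<Psi> = {(x, r). \<Psi> x \<le> ereal r}"

definition closed_fun :: "('a::euclidean_space \<Rightarrow> ereal) \<Rightarrow> bool" where
  "closed_fun \<Psi> \<longleftrightarrow> closed (ext_epigraph \<Psi>)"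

definition convex_fun :: "('a::euclidean_space \<Rightarrow> ereal) \<Rightarrow> bool" where
  "convex_fun \<Psi> \<longleftrightarrow> convex (ext_epigraph \<Psi>)"

definition proper_fun :: "('a \<Rightarrow> ereal) \<Rightarrow> bool" where
  "proper_fun \<Psi> \<longleftrightarrow> (\<forall>x. \<Psi> x \<noteq> -\<infinity>) \<and> (\<exists>x. \<Psi> x \<noteq> \<infinity>)"

(* prox t \<Psi> is the proximal operator of t\<Psi>. The minimizer exists and is unique for t > 0
   and \<Psi> closed, proper and convex. *)
definition prox :: "real \<Rightarrow> ('a::euclidean_space \<Rightarrow> ereal) \<Rightarrow> 'a \<Rightarrow> 'a" where
  "prox t \<Psi> x = arg_min (\<lambda>z. \<Psi> z + ereal ((norm (x - z))\<^sup>2 / (2 * t))) (\<lambda>_. True)"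

definition accelerated_gradient ::
  "('a::euclidean_space \<Rightarrow> real) \<Rightarrow> ('a \<Rightarrow> ereal) \<Rightarrow> real \<Rightarrow> real \<Rightarrow> 'a
    \<Rightarrow> (nat \<Rightarrow> 'a) \<Rightarrow> (nat \<Rightarrow> 'a) \<Rightarrow> bool" where
  "accelerated_gradient f \<Psi> L \<kappa> x0 x w \<longleftrightarrow>
     x 0 = x0 \<and> w 0 = x0 \<and>
     (\<forall>k\<ge>1.
        x k = prox (1 / L) \<Psi> (w (k - 1) - (1 / L) *\<^sub>R grad f (w (k - 1))) \<and>
        w k = x k + ((sqrt \<kappa> - 1) / (sqrt \<kappa> + 1)) *\<^sub>R (x k - x (k - 1)))"

definition y_seq :: "real \<Rightarrow> (nat \<Rightarrow> 'a::euclidean_space) \<Rightarrow> nat \<Rightarrow> 'a" where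
  "y_seq \<kappa> x k = (if k = 0 then x 0 else x k + (sqrt \<kappa> - 1) *\<^sub>R (x k - x (k - 1)))"

(* sigma_sq ... k is the number written as the square of sigma-tilde with index k. It is real
   whenever F (x 0) and F xs are finite; extended real values only serve to cover
   F (x 0) = \<infinity> as well. *)
primrec sigma_sq ::
  "('a::euclidean_space \<Rightarrow> ereal) \<Rightarrow> real \<Rightarrow> real \<Rightarrow> 'a
    \<Rightarrow> (nat \<Rightarrow> 'a) \<Rightarrow> (nat \<Rightarrow> 'a) \<Rightarrow> nat \<Rightarrow> ereal" where
  "sigma_sq F \<alpha> \<kappa> xs x w 0 =
     ereal ((norm (y_seq \<kappa> x 0 - xs))\<^sup>2) + 2 * (F (x 0) - F xs) / ereal \<alpha>"
| "sigma_sq F \<alpha> \<kappa> xs x w (Suc k) =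
     ereal (1 - \<kappa> powr (-1/2)) * sigma_sq F \<alpha> \<kappa> xs x w k
     - ereal ((\<kappa> powr (1/2) - \<kappa> powr (-1/2)) * (norm (w k - x k))\<^sup>2)"

end

theory Submission
  imports Defs
begin

text \<open>
  First-order optimality of a prox step and the two quadratic bounds on \<open>f\<close> give, for
  \<open>p = prox (w - \<nabla>f(w)/L)\<close> and every \<open>z\<close>,
  \<open>F(z) - F(p) \<ge> \<alpha>/2 |z - w|^2 - L/2 |p - w|^2 - L (p - w) \<bullet> (z - p)\<close>.
  Take the convex combination of the cases \<open>z = x*\<close> and \<open>z = x_k\<close> with weights
  \<open>1/sqrt \<kappa>\<close> and \<open>1 - 1/sqrt \<kappa>\<close>. Since \<open>y_k - x_k = (sqrt \<kappa> + 1) (w_k - x_k)\<close>, the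
  quadratic terms of the result match those of the recursion for \<open>\<sigma>\<close> identically.
  Existence of the prox needs an affine minorant of \<open>\<Psi>\<close>, which first-order optimality of
  \<open>F\<close> at \<open>x*\<close> supplies.
\<close>

section \<open>Optimality conditions and existence of the prox\<close>

text \<open>Compare \<open>p\<close> with \<open>p + t *\<^sub>R (z - p)\<close>: convexity makes
  the change of \<open>\<Psi>\<close> at most linear in \<open>t\<close>, and \<open>h\<close> adds
  a linear term and one of order \<open>t\<^sup>2\<close>. Dividing by \<open>t\<close> and letting
  \<open>t\<close> tend to 0 from the right shows that \<open>- g\<close> is a subgradient of
  \<open>\<Psi>\<close> at \<open>p\<close>. The form covers both \<open>f\<close> at
  \<open>xs\<close> and the squared distance in the prox.\<close>

lemma first_order_optimality:
  fixes \<Psi> :: "'a::euclidean_space \<Rightarrow> ereal"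
  assumes conv: "convex_fun \<Psi>"
    and min: "is_arg_min (\<lambda>z. ereal (h z) + \<Psi> z) (\<lambda>_. True) p"
    and upper: "\<And>z. h z \<le> h p + g \<bullet> (z - p) + (M / 2) * (norm (z - p))\<^sup>2"
    and p: "\<Psi> p = ereal a" and z: "\<Psi> z \<le> ereal b"
  shows "a - g \<bullet> (z - p) \<le> b"
proof -
  define C where "C = b - a + g \<bullet> (z - p)"
  define D where "D = (M / 2) * (norm (z - p))\<^sup>2"
  have CD: "0 \<le> C + t * D" if t: "0 < t" "t \<le> 1" for t
  proof -
    let ?u = "p + t *\<^sub>R (z - p)"
    have "(1 - t) *\<^sub>R (p, a) + t *\<^sub>R (z, b) \<in> ext_epigraph \<Psi>"
      using conv p z t unfolding convex_fun_def
      by (intro convexD_alt) (auto simp: ext_epigraph_def)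
    moreover have "(1 - t) *\<^sub>R (p, a) + t *\<^sub>R (z, b) = (?u, a + t * (b - a))"
      by (simp add: algebra_simps)
    ultimately have "\<Psi> ?u \<le> ereal (a + t * (b - a))"
      by (simp add: ext_epigraph_def)
    moreover have "ereal (h p) + \<Psi> p \<le> ereal (h ?u) + \<Psi> ?u"
      using min by (auto simp: is_arg_min_def not_less)
    ultimately have "ereal (h p) + ereal a \<le> ereal (h ?u) + ereal (a + t * (b - a))"
      using p by (metis add_left_mono order_trans)
    then have "h p + a \<le> h ?u + (a + t * (b - a))"
      by simp
    with upper[of ?u] have "0 \<le> g \<bullet> (t *\<^sub>R (z - p)) + (M / 2) * (norm (t *\<^sub>R (z - p)))\<^sup>2 + t * (b - a)"
      by simp
    also have "\<dots> = t * (C + t * D)"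
      using t by (simp add: C_def D_def power_mult_distrib power2_eq_square distrib_left mult_ac
          right_diff_distrib)
    finally show ?thesis
      using t by (simp add: zero_le_mult_iff)
  qed
  have "((\<lambda>t. C + t * D) \<longlongrightarrow> C + 0 * D) (at_right 0)"
    by (intro tendsto_intros)
  moreover have "eventually (\<lambda>t. 0 \<le> C + t * D) (at_right 0)"
    using CD by (intro eventually_at_rightI[of 0 1]) auto
  ultimately have "0 \<le> C + 0 * D"
    by (rule tendsto_lowerbound) simp
  then show ?thesis
    by (simp add: C_def)
qed

text \<open>Minimizing over the epigraph replaces \<open>\<Psi>\<close> by the height coordinate, so
  the objective becomes continuous. Its sublevel set \<open>S\<close> is closed because
  \<open>\<Psi>\<close> is, and bounded because the square dominates the affine minorant.\<close>

lemma prox_is_arg_min: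
  fixes \<Psi> :: "'a::euclidean_space \<Rightarrow> ereal"
  assumes "t > 0" and closed: "closed_fun \<Psi>"
    and fin: "\<Psi> v = ereal a"
    and minorant: "\<And>z b. \<Psi> z \<le> ereal b \<Longrightarrow> a - g \<bullet> (z - v) \<le> b"
  shows "is_arg_min (\<lambda>z. ereal ((norm (c - z))\<^sup>2 / (2 * t)) + \<Psi> z) (\<lambda>_. True) (prox t \<Psi> c)"
proof -
  define q where "q z = (norm (c - z))\<^sup>2 / (2 * t)" for z
  define R where "R = a + q v"
  \<comment> \<open>Points of \<open>S\<close> at distance \<open>?n\<close> from \<open>c\<close>
    satisfy \<open>?n\<^sup>2 \<le> K + G * ?n\<close>, which forces \<open>?n \<le> N\<close>;
    \<open>lo\<close> is a lower bound for the minorant on that ball.\<close>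
  define K where "K = \<bar>2 * t * (R - a + g \<bullet> (c - v))\<bar>"
  define G where "G = 2 * t * norm g"
  define N where "N = 1 + K + G"
  define lo where "lo = a - norm g * (N + norm (c - v))"
  define S where "S = ext_epigraph \<Psi> \<inter> {u. snd u + q (fst u) \<le> R}"
  have contq: "continuous_on A (\<lambda>u. snd u + q (fst u))" for A :: "('a \<times> real) set"
    unfolding q_def using \<open>t > 0\<close> by (intro continuous_intros) auto
  have "closed S"
    unfolding S_def using closed[unfolded closed_fun_def]
    by (intro closed_Int closed_Collect_le[OF contq] continuous_intros)
  have "S \<subseteq> cball c N \<times> {lo..R}"
  proof (rule subrelI)
    fix z r assume "(z, r) \<in> S"
    then have zr: "\<Psi> z \<le> ereal r" "r + q z \<le> R"
      by (auto simp: S_def ext_epigraph_def)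
    have r: "a - g \<bullet> (z - v) \<le> r"
      by (rule minorant[OF zr(1)])
    let ?n = "norm (c - z)"
    have cs: "g \<bullet> (z - c) \<le> norm g * ?n"
      using Cauchy_Schwarz_ineq2[of g "z - c"] by (simp add: norm_minus_commute)
    have "q z \<le> R - a + g \<bullet> (c - v) + norm g * ?n"
      using r zr(2) cs by (simp add: inner_diff_right)
    then have "?n\<^sup>2 \<le> 2 * t * (R - a + g \<bullet> (c - v) + norm g * ?n)"
      using \<open>t > 0\<close> by (simp add: q_def field_simps)
    also have "\<dots> \<le> K + G * ?n"
      unfolding K_def G_def by (simp add: algebra_simps)
    finally have n2: "?n\<^sup>2 \<le> K + G * ?n" .
    have KG: "K \<ge> 0" "G \<ge> 0"
      using \<open>t > 0\<close> by (auto simp: K_def G_def)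
    have n: "?n \<le> N"
    proof (rule ccontr)
      assume "\<not> ?n \<le> N"
      then have big: "?n > 1 + K + G"
        by (simp add: N_def)
      have "K * 1 \<le> K * ?n"
        using KG big by (intro mult_left_mono) auto
      moreover have "(1 + K + G) * ?n < ?n * ?n"
        using KG big by (intro mult_strict_right_mono) auto
      ultimately show False
        using n2 big KG by (simp add: power2_eq_square algebra_simps)
    qed
    have "g \<bullet> (z - v) \<le> norm g * norm (z - v)"
      by (rule norm_cauchy_schwarz)
    also have "\<dots> \<le> norm g * (N + norm (c - v))"
      using n norm_triangle_ineq[of "z - c" "c - v"]
      by (intro mult_left_mono) (auto simp: norm_minus_commute)
    finally have "lo \<le> r"
      using r by (simp add: lo_def)
    moreover have "q z \<ge> 0"
      using \<open>t > 0\<close> by (simp add: q_def)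
    ultimately show "(z, r) \<in> cball c N \<times> {lo..R}"
      using n zr by (simp add: dist_norm)
  qed
  then have "S = S \<inter> (cball c N \<times> {lo..R})"
    by blast
  then have "compact S"
    using closed_Int_compact[OF \<open>closed S\<close>] by (metis compact_cball compact_Icc compact_Times)
  moreover have "(v, a) \<in> S"
    by (simp add: S_def ext_epigraph_def fin R_def)
  ultimately obtain u where u: "u \<in> S"
    "\<And>s. s \<in> S \<Longrightarrow> snd u + q (fst u) \<le> snd s + q (fst s)"
    using continuous_attains_inf[OF _ _ contq, of S] by blast
  have uR: "snd u + q (fst u) \<le> R" and u\<Psi>: "\<Psi> (fst u) \<le> ereal (snd u)"
    using u(1) by (auto simp: S_def ext_epigraph_def)
  have "is_arg_min (\<lambda>z. ereal (q z) + \<Psi> z) (\<lambda>_. True) (fst u)"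
    unfolding is_arg_min_def
  proof safe
    fix z assume less: "ereal (q z) + \<Psi> z < ereal (q (fst u)) + \<Psi> (fst u)"
    also have "\<dots> \<le> ereal (q (fst u)) + ereal (snd u)"
      using u\<Psi> by (rule add_left_mono)
    finally have less': "ereal (q z) + \<Psi> z < ereal (q (fst u) + snd u)"
      by simp
    show False
    proof (cases "\<Psi> z")
      case (real r)
      then have "(z, r) \<in> S"
        using less' uR by (simp add: S_def ext_epigraph_def)
      with u(2)[of "(z, r)"] less' real show False
        by simp
    next
      case PInf
      with less' show False by simp
    next
      case MInf
      then have "\<Psi> z \<le> ereal (a - g \<bullet> (z - v) - 1)"
        by simp
      from minorant[OF this] show False by simp
    qed
  qed
  \<comment> \<open>\<open>arg_min\<close> is a Hilbert choice, so one minimizer suffices for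
    \<open>prox\<close> to be one.\<close>
  then show ?thesis
    unfolding prox_def arg_min_def q_def add.commute[of "\<Psi> _"] by (rule someI)
qed

section \<open>Estimates for one proximal gradient step\<close>

text \<open>The two bounds are compared at 0 and a unit vector. This yields
  \<open>\<kappa> \<ge> 1\<close>, so that \<open>1 / q\<close> and \<open>1 - 1 / q\<close> are
  convex weights in the main proof.\<close>

lemma smooth_strongly_convex_le:
  fixes f :: "'a::euclidean_space \<Rightarrow> real"
  assumes "L_smooth L f" "strongly_convex \<alpha> f"
  shows "\<alpha> \<le> L"
proof -
  obtain e :: 'a where e: "norm e = 1"
    using vector_choose_size[of 1] by auto
  have "\<bar>f e - f 0 - grad f 0 \<bullet> (e - 0)\<bar> \<le> (L / 2) * (norm (e - 0))\<^sup>2"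
    using assms(1) unfolding L_smooth_def by blast
  moreover have "f e \<ge> f 0 + grad f 0 \<bullet> (e - 0) + (\<alpha> / 2) * (norm (0 - e))\<^sup>2"
    using assms(2) unfolding strongly_convex_def by blast
  ultimately have "\<bar>f e - f 0 - grad f 0 \<bullet> e\<bar> \<le> L / 2" "f e \<ge> f 0 + grad f 0 \<bullet> e + \<alpha> / 2"
    using e by simp_all
  then show ?thesis by linarith
qed

text \<open>Three inequalities are added: the subgradient inequality for \<open>\<Psi>\<close> at
  \<open>p w\<close>, strong convexity from \<open>w\<close> to \<open>z\<close>, and smoothness
  from \<open>w\<close> to \<open>p w\<close>. The terms with \<open>grad f w\<close>
  cancel.\<close>

lemma prox_gradient_step:
  fixes f :: "'a::euclidean_space \<Rightarrow> real" and \<Psi> :: "'a \<Rightarrow> ereal"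
  assumes "L > 0" and smooth: "L_smooth L f" and sconv: "strongly_convex \<alpha> f"
    and closed: "closed_fun \<Psi>" and proper: "proper_fun \<Psi>" and conv: "convex_fun \<Psi>"
    and min: "is_arg_min (\<lambda>z. ereal (f z) + \<Psi> z) (\<lambda>_. True) xs"
  defines "p \<equiv> \<lambda>w. prox (1 / L) \<Psi> (w - (1 / L) *\<^sub>R grad f w)"
  obtains a where "\<Psi> (p w) = ereal a"
    and "\<And>z b. \<Psi> z = ereal b \<Longrightarrow>
      f (p w) + a \<le> f z + b - \<alpha> / 2 * (norm (z - w))\<^sup>2 + L / 2 * (norm (p w - w))\<^sup>2
        + L * ((p w - w) \<bullet> (z - p w))"
proof -
  define c where "c = w - (1 / L) *\<^sub>R grad f w"
  define h where "h z = (norm (c - z))\<^sup>2 / (2 * (1 / L))" for z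
  obtain v where "\<Psi> v \<noteq> \<infinity>" and notMInf: "\<And>z. \<Psi> z \<noteq> -\<infinity>"
    using proper unfolding proper_fun_def by blast
  have finite_min: "\<exists>a. \<Psi> u = ereal a" if "is_arg_min (\<lambda>z. ereal (k z) + \<Psi> z) (\<lambda>_. True) u" for k u
  proof -
    have "ereal (k u) + \<Psi> u \<le> ereal (k v) + \<Psi> v"
      using that by (auto simp: is_arg_min_def not_less)
    then have "\<Psi> u \<noteq> \<infinity>"
      using \<open>\<Psi> v \<noteq> \<infinity>\<close> by auto
    with notMInf[of u] show ?thesis
      by (cases "\<Psi> u") auto
  qed
  obtain as where as: "\<Psi> xs = ereal as"
    using finite_min[OF min] by blast
  have upper: "f z \<le> f u + grad f u \<bullet> (z - u) + L / 2 * (norm (z - u))\<^sup>2" for z u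
  proof -
    have "\<bar>f z - f u - grad f u \<bullet> (z - u)\<bar> \<le> L / 2 * (norm (z - u))\<^sup>2"
      using smooth unfolding L_smooth_def by blast
    then show ?thesis by linarith
  qed
  have minorant: "as - grad f xs \<bullet> (z - xs) \<le> b" if "\<Psi> z \<le> ereal b" for z b
    by (rule first_order_optimality[OF conv min upper as that])
  have pmin: "is_arg_min (\<lambda>z. ereal (h z) + \<Psi> z) (\<lambda>_. True) (p w)"
    unfolding h_def p_def c_def[symmetric] using \<open>L > 0\<close>
    by (intro prox_is_arg_min[OF _ closed as minorant]) auto
  obtain a where a: "\<Psi> (p w) = ereal a"
    using finite_min[OF pmin] by blast
  \<comment> \<open>This is the gradient of \<open>h\<close> at \<open>p w\<close>, namely
    \<open>L *\<^sub>R (p w - c)\<close>, with \<open>c\<close> expanded.\<close>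
  define g where "g = L *\<^sub>R (p w - w) + grad f w"
  have quad: "h z \<le> h (p w) + g \<bullet> (z - p w) + L / 2 * (norm (z - p w))\<^sup>2" for z
  proof -
    have g: "g = L *\<^sub>R (p w - c)"
      using \<open>L > 0\<close> by (simp add: g_def c_def algebra_simps)
    have "(norm (c - z))\<^sup>2 = (norm (c - p w))\<^sup>2 + 2 * ((p w - c) \<bullet> (z - p w)) + (norm (z - p w))\<^sup>2"
      unfolding power2_norm_eq_inner by (simp add: algebra_simps inner_commute)
    then have "h z = L / 2 * ((norm (c - p w))\<^sup>2 + 2 * ((p w - c) \<bullet> (z - p w)) + (norm (z - p w))\<^sup>2)"
      using \<open>L > 0\<close> by (simp add: h_def)
    also have "\<dots> = h (p w) + g \<bullet> (z - p w) + L / 2 * (norm (z - p w))\<^sup>2"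
      using \<open>L > 0\<close> by (simp add: h_def g distrib_left)
    finally show ?thesis by simp
  qed
  show ?thesis
  proof (rule that[OF a])
    fix z b assume "\<Psi> z = ereal b"
    then have opt: "a - g \<bullet> (z - p w) \<le> b"
      by (intro first_order_optimality[OF conv pmin quad a]) simp
    have lower: "f z \<ge> f w + grad f w \<bullet> (z - w) + \<alpha> / 2 * (norm (w - z))\<^sup>2"
      using sconv unfolding strongly_convex_def by blast
    have "g \<bullet> (z - p w) = L * ((p w - w) \<bullet> (z - p w)) + grad f w \<bullet> (z - w) - grad f w \<bullet> (p w - w)"
      by (simp add: g_def algebra_simps)
    with opt lower upper[of "p w" w]
    show "f (p w) + a \<le> f z + b - \<alpha> / 2 * (norm (z - w))\<^sup>2 + L / 2 * (norm (p w - w))\<^sup>2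
        + L * ((p w - w) \<bullet> (z - p w))"
      by (simp add: norm_minus_commute)
  qed
qed

section \<open>Algebra of the momentum step\<close>

text \<open>With \<open>p\<close> as the next iterate and \<open>e\<close> as the minimizer, the
  first norm is the distance of the next \<open>y\<close> from the minimizer. After translation by
  \<open>x\<close>, both sides are combinations of inner products of \<open>W\<close>,
  \<open>P\<close>, \<open>E\<close> with equal coefficients.\<close>

lemma accelerated_quadratic_identity:
  fixes x y w p e :: "'a::real_inner"
  assumes "q \<noteq> 0" and y: "y - x = (q + 1) *\<^sub>R (w - x)"
  shows "(norm (p + (q - 1) *\<^sub>R (p - x) - e))\<^sup>2
      - (1 / q) * (norm (e - w))\<^sup>2 - (1 - 1 / q) * (norm (x - w))\<^sup>2 + q\<^sup>2 * (norm (p - w))\<^sup>2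
      + 2 * q\<^sup>2 * ((p - w) \<bullet> ((1 / q) *\<^sub>R (e - p) + (1 - 1 / q) *\<^sub>R (x - p)))
    = (1 - 1 / q) * (norm (y - e))\<^sup>2 - (q - 1 / q) * (norm (w - x))\<^sup>2"
proof -
  define W P E where "W = w - x" and "P = p - x" and "E = e - x"
  \<comment> \<open>The letters \<open>a\<close>, \<open>b\<close>, \<open>c\<close> stand for the
    squared norms of \<open>P\<close>, \<open>E\<close>, \<open>W\<close>, and \<open>d\<close>,
    \<open>g\<close>, \<open>h\<close> for the products \<open>P \<bullet> E\<close>,
    \<open>E \<bullet> W\<close>, \<open>P \<bullet> W\<close>. Writing \<open>s\<close> for
    \<open>1 / q\<close> keeps the identity polynomial.\<close>
  have poly: "q\<^sup>2 * a - 2 * q * d + b - s * (b - 2 * g + c) - (1 - s) * c + q\<^sup>2 * (a - 2 * h + c)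
      + 2 * q\<^sup>2 * (s * d - a - s * g + h)
    = (1 - s) * ((q + 1)\<^sup>2 * c - 2 * (q + 1) * g + b) - (q - s) * c"
    if "q * s = 1" for a b c d g h s :: real
    using that by algebra
  have "p + (q - 1) *\<^sub>R (p - x) - e = q *\<^sub>R P - E"
    by (simp add: P_def E_def algebra_simps)
  moreover have "y - e = (q + 1) *\<^sub>R W - E"
    using y by (simp add: W_def E_def algebra_simps)
  moreover have "e - w = E - W" "x - w = - W" "p - w = P - W" "w - x = W" "e - p = E - P" "x - p = - P"
    by (simp_all add: W_def P_def E_def)
  moreover have "(norm (q *\<^sub>R P - E))\<^sup>2 = q\<^sup>2 * (P \<bullet> P) - 2 * q * (P \<bullet> E) + E \<bullet> E"
    "(norm ((q + 1) *\<^sub>R W - E))\<^sup>2 = (q + 1)\<^sup>2 * (W \<bullet> W) - 2 * (q + 1) * (E \<bullet> W) + E \<bullet> E"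
    "(norm (E - W))\<^sup>2 = E \<bullet> E - 2 * (E \<bullet> W) + W \<bullet> W"
    "(norm (P - W))\<^sup>2 = P \<bullet> P - 2 * (P \<bullet> W) + W \<bullet> W"
    unfolding power2_norm_eq_inner
    by (simp_all add: inner_diff_left inner_diff_right inner_commute power2_eq_square algebra_simps)
  moreover have "(P - W) \<bullet> (s *\<^sub>R (E - P) + (1 - s) *\<^sub>R (- P)) =
      s * (P \<bullet> E) - P \<bullet> P - s * (E \<bullet> W) + P \<bullet> W" for s
    by (simp add: inner_commute algebra_simps)
  ultimately show ?thesis
    using poly[of "1 / q" "P \<bullet> P" "P \<bullet> E" "E \<bullet> E" "E \<bullet> W" "W \<bullet> W" "P \<bullet> W"] \<open>q \<noteq> 0\<close>
    by (simp add: power2_norm_eq_inner[of W])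
qed

section \<open>Decrease of the potential and induction\<close>

theorem lemma6p2:
  fixes f :: "real ^ 'n \<Rightarrow> real" and \<Psi> F :: "real ^ 'n \<Rightarrow> ereal"
    and L \<alpha> \<kappa> :: real
    and x0 xs :: "real ^ 'n"
    and x w :: "nat \<Rightarrow> real ^ 'n"
  assumes "L > 0" and "\<alpha> > 0"
    and "L_smooth L f" and "strongly_convex \<alpha> f"
    and "closed_fun \<Psi>" and "proper_fun \<Psi>" and "convex_fun \<Psi>"
    and "F = (\<lambda>z. ereal (f z) + \<Psi> z)"
    and "is_arg_min F (\<lambda>_. True) xs"
    and "\<kappa> = L / \<alpha>"
    and "accelerated_gradient f \<Psi> L \<kappa> x0 x w"
  shows "\<forall>k. ereal ((norm (y_seq \<kappa> x k - xs))\<^sup>2) + 2 * (F (x k) - F xs) / ereal \<alpha>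
           \<le> sigma_sq F \<alpha> \<kappa> xs x w k"
proof -
  define q where "q = sqrt \<kappa>"
  have "\<kappa> \<ge> 1"
    using smooth_strongly_convex_le[OF assms(3,4)] assms(1,2,10) by simp
  then have q: "q \<ge> 1" "q\<^sup>2 = \<kappa>" "\<kappa> powr (1/2) = q" "\<kappa> powr (-1/2) = 1 / q"
    by (simp_all add: q_def powr_half_sqrt powr_minus_divide)
  have L: "L = \<alpha> * q\<^sup>2"
    using assms(2,10) q by simp
  have min: "is_arg_min (\<lambda>z. ereal (f z) + \<Psi> z) (\<lambda>_. True) xs"
    using assms(8,9) by simp
  have notMInf: "\<Psi> z \<noteq> -\<infinity>" for z
    using assms(6) by (simp add: proper_fun_def)
  obtain v where "\<Psi> v \<noteq> \<infinity>"
    using assms(6) unfolding proper_fun_def by blast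
  moreover have "F xs \<le> F v"
    using assms(9) by (auto simp: is_arg_min_def not_less)
  ultimately obtain as where as: "\<Psi> xs = ereal as"
    using notMInf[of xs] assms(8) by (cases "\<Psi> xs") auto
  have x_Suc: "x (Suc k) = prox (1 / L) \<Psi> (w k - (1 / L) *\<^sub>R grad f (w k))" for k
    using assms(11) unfolding accelerated_gradient_def
    by (metis diff_Suc_1 le_add1 plus_1_eq_Suc)
  \<comment> \<open>The momentum coefficient times \<open>q + 1\<close> is \<open>q - 1\<close>; at
    index 0 both sides vanish.\<close>
  have y_minus_x: "y_seq \<kappa> x k - x k = (q + 1) *\<^sub>R (w k - x k)" for k
  proof (cases k)
    case 0
    then show ?thesis
      using assms(11) by (simp add: accelerated_gradient_def y_seq_def)
  next
    case (Suc j)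
    then have "w k - x k = ((q - 1) / (q + 1)) *\<^sub>R (x k - x (k - 1))"
      using assms(11) by (simp add: accelerated_gradient_def q_def)
    moreover have "q + 1 \<noteq> 0"
      using q(1) by simp
    ultimately show ?thesis
      using Suc by (simp add: y_seq_def q_def[symmetric])
  qed
  have step: "ereal ((norm (y_seq \<kappa> x (Suc k) - xs))\<^sup>2) + 2 * (F (x (Suc k)) - F xs) / ereal \<alpha>
      \<le> ereal (1 - 1 / q) * (ereal ((norm (y_seq \<kappa> x k - xs))\<^sup>2) + 2 * (F (x k) - F xs) / ereal \<alpha>)
        - ereal ((q - 1 / q) * (norm (w k - x k))\<^sup>2)" for k
  proof -
    define p where "p = x (Suc k)"
    obtain a where a: "\<Psi> p = ereal a"
      and bound: "\<And>z b. \<Psi> z = ereal b \<Longrightarrow>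
        f p + a \<le> f z + b - \<alpha> / 2 * (norm (z - w k))\<^sup>2 + L / 2 * (norm (p - w k))\<^sup>2
          + L * ((p - w k) \<bullet> (z - p))"
      using prox_gradient_step[OF assms(1,3-7) min, of "w k"] unfolding p_def x_Suc by metis
    let ?G = "f p + a - (f xs + as)"
    \<comment> \<open>\<open>H\<close> plays the role of \<open>F (x k) - F xs\<close>. If
      \<open>q = 1\<close>, its weight \<open>1 - 1 / q\<close> is zero and \<open>H\<close> may be
      any real, which serves the case of infinite \<open>F (x k)\<close>.\<close>
    have real_step: "(norm (y_seq \<kappa> x (Suc k) - xs))\<^sup>2 + 2 * ?G / \<alpha>
        \<le> (1 - 1 / q) * ((norm (y_seq \<kappa> x k - xs))\<^sup>2 + 2 * H / \<alpha>)
          - (q - 1 / q) * (norm (w k - x k))\<^sup>2"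
      if H: "q = 1 \<or> \<Psi> (x k) = ereal (H + (f xs + as) - f (x k))" for H
    proof -
      \<comment> \<open>\<open>bound\<close> says that \<open>F p - F z \<le> B z\<close> wherever
        \<open>\<Psi> z\<close> is finite; it is used at \<open>xs\<close> and at
        \<open>x k\<close>.\<close>
      define B where "B z = - \<alpha> / 2 * (norm (z - w k))\<^sup>2 + L / 2 * (norm (p - w k))\<^sup>2
          + L * ((p - w k) \<bullet> (z - p))" for z
      have "?G \<le> B xs"
        using bound[OF as] by (simp add: B_def)
      then have "(1 / q) * ?G \<le> (1 / q) * B xs"
        using q by (intro mult_left_mono) auto
      moreover have "(1 - 1 / q) * ?G \<le> (1 - 1 / q) * (H + B (x k))"
      proof (cases "q = 1")
        case False
        then have "?G \<le> H + B (x k)"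
          using bound[of "x k"] H by (fastforce simp: B_def)
        then show ?thesis
          using q by (intro mult_left_mono) auto
      qed simp
      ultimately have "?G \<le> (1 - 1 / q) * H + ((1 / q) * B xs + (1 - 1 / q) * B (x k))"
        by (simp add: algebra_simps)
      then have "2 / \<alpha> * ?G \<le> 2 / \<alpha> * ((1 - 1 / q) * H + ((1 / q) * B xs + (1 - 1 / q) * B (x k)))"
        using assms(2) by (intro mult_left_mono) auto
      also have "\<dots> = (1 - 1 / q) * (2 * H / \<alpha>)
          - (1 / q) * (norm (xs - w k))\<^sup>2 - (1 - 1 / q) * (norm (x k - w k))\<^sup>2
          + q\<^sup>2 * (norm (p - w k))\<^sup>2
          + 2 * q\<^sup>2 * ((p - w k) \<bullet> ((1 / q) *\<^sub>R (xs - p) + (1 - 1 / q) *\<^sub>R (x k - p)))"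
        using assms(2) q(1) unfolding B_def L inner_add_right inner_scaleR_right
        by (simp add: field_simps)
      also have "\<dots> = (1 - 1 / q) * ((norm (y_seq \<kappa> x k - xs))\<^sup>2 + 2 * H / \<alpha>)
          - (q - 1 / q) * (norm (w k - x k))\<^sup>2 - (norm (y_seq \<kappa> x (Suc k) - xs))\<^sup>2"
        using accelerated_quadratic_identity[OF _ y_minus_x[of k], where p = p and e = xs] q(1)
        by (simp add: y_seq_def p_def q_def[symmetric] distrib_left)
      finally show ?thesis
        by simp
    qed
    have Fp: "F (x (Suc k)) = ereal (f p + a)" and Fxs: "F xs = ereal (f xs + as)"
      using a as assms(8) by (simp_all add: p_def)
    show ?thesis
    proof (cases "\<Psi> (x k)")
      case (real b)
      then show ?thesis
        using real_step[of "f (x k) + b - (f xs + as)"] assms(2)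
        by (simp add: Fp Fxs assms(8)[THEN fun_cong, of "x k"])
    next
      \<comment> \<open>Only \<open>k = 0\<close> can lead here, since \<open>\<Psi>\<close> is
        finite at every prox point.\<close>
      case PInf
      then have inf: "2 * (F (x k) - F xs) / ereal \<alpha> = \<infinity>"
        using assms(2) by (simp add: Fxs assms(8)[THEN fun_cong, of "x k"])
      show ?thesis
      \<comment> \<open>For \<open>q = 1\<close> the right-hand side is finite, since \<open>0 * \<infinity> = 0\<close> in the extended reals.\<close>
      proof (cases "q = 1")
        case True
        then show ?thesis
          using real_step[of 0] assms(2) by (simp add: Fp Fxs flip: zero_ereal_def)
      next
        case False
        then show ?thesis
          unfolding inf using q by simp
      qed
    next
      case MInf
      with notMInf show ?thesis by blast
    qed
  qed
  show ?thesis
  proof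
    fix k
    show "ereal ((norm (y_seq \<kappa> x k - xs))\<^sup>2) + 2 * (F (x k) - F xs) / ereal \<alpha>
        \<le> sigma_sq F \<alpha> \<kappa> xs x w k"
    proof (induction k)
      case 0
      show ?case by simp
    next
      case (Suc k)
      have "0 \<le> ereal (1 - 1 / q)"
        using q by simp
      from ereal_mult_left_mono[OF Suc this] show ?case
        unfolding sigma_sq.simps q by (intro order_trans[OF step] ereal_minus_mono) auto
    qed
  qed
qed

end
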